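(* Let $p$ and $G$ (with constants $\alpha,\beta,\eta_0,C_0$) satisfy the assumptions in the context, and fix $q\in(1,p^-)$. If $u\in\mathscr K_{\mathrm{hybrid}}$, then $$\|u\|_{L^{\frac{p(\cdot)}{q}}}\ge\eta_0(\beta-\alpha)^{\frac{q}{p^-}}\|u\|_\infty,$$ and, hence, $$\eta_0(\beta-\alpha)^{q/p^-}\|u\|_{L^{p(\cdot)}}\le\|u\|_{L^{\frac{p(\cdot)}{q}}}.$$
   Context: Assumption on $p$: $p:[0,1]\to(1,+\infty)$ is continuous, with $1<p^-:=\min_{[0,1]}p\le p(t)\le p^+:=\max_{[0,1]}p<+\infty$. Assumption on $G$: $G:[0,1]\times[0,1]\to[0,+\infty)$ is a Green's function such that, with $\mathscr G(s):=\max_{t\in[0,1]}G(t,s)$, one has $\mathscr G(s)>0$ for all $s\in(0,1)$; there are $0\le\alpha<\beta\le1$ and $\eta_0\in(0,1]$ with $\min_{t\in[\alpha,\beta]}G(t,s)\ge\eta_0\mathscr G(s)$ for all $s\in[0,1]$; and $C_0:=\inf_{s\in(0,1)}\frac{1}{\mathscr G(s)}\int_0^1G(t,s)\,dt$ satisfies $0<C_0<1$. For a continuous exponent $r:[0,1]\to(1,+\infty)$, $\|u\|_{L^{r(\cdot)}}:=\inf\{\delta>0:\int_0^1|u(x)/\delta|^{r(x)}\,dx\le1\}$ (Luxemburg norm); $\|\cdot\|_\infty$ is the supremum norm. The cone $\mathscr K_{\mathrm{hybrid}}$ is the set of $u\in\mathscr C([0,1])$ such that $u\ge0$, $\min_{t\in[\alpha,\beta]}u(t)\ge\eta_0\|u\|_\infty$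 and $\int_0^1u(t)\,dt\ge C_0\|u\|_{L^{p(\cdot)}}$. *)

theory Defs
  imports "HOL-Analysis.Analysis"
begin

(* Functions on [0,1] are functions of type real => real (kernels: real => real => real)
   whose values outside {0..1} play no role. *)

definition admissible_exponent :: "(real \<Rightarrow> real) \<Rightarrow> bool" where
  "admissible_exponent r \<longleftrightarrow> continuous_on {0..1} r \<and> (\<forall>t\<in>{0..1}. 1 < r t)"

(* INF is used for the minimum p^-; for continuous p it is attained on the compact interval. *)
definition exponent_min :: "(real \<Rightarrow> real) \<Rightarrow> real" where
  "exponent_min p = (INF t\<in>{0..1}. p t)"

definition sup_norm :: "(real \<Rightarrow> real) \<Rightarrow> real" where
  "sup_norm u = (SUP t\<in>{0..1}. \<bar>u t\<bar>)"

(* The modular is taken as a nonnegative extended integral, so that a scale delta whose modular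
   is infinite is excluded rather than receiving the default value 0 of the Bochner integral. *)
definition luxemburg_norm :: "(real \<Rightarrow> real) \<Rightarrow> (real \<Rightarrow> real) \<Rightarrow> real" where
  "luxemburg_norm r u =
     Inf {\<delta>. 0 < \<delta> \<and>
       (\<integral>\<^sup>+ x. ennreal (\<bar>u x / \<delta>\<bar> powr r x) \<partial>(lebesgue_on {0..1})) \<le> 1}"

definition green_max :: "(real \<Rightarrow> real \<Rightarrow> real) \<Rightarrow> real \<Rightarrow> real" where
  "green_max G s = (SUP t\<in>{0..1}. G t s)"

definition green_C0 :: "(real \<Rightarrow> real \<Rightarrow> real) \<Rightarrow> real" where
  "green_C0 G =
     (INF s\<in>{0<..<1}. 1 / green_max G s * integral\<^sup>L (lebesgue_on {0..1}) (\<lambda>t. G t s))"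

(* G is an abstract kernel: no boundary value problem and no continuity is imposed on it.
   The existential clauses say that the suprema and infima over t are attained, i.e. that
   they are the maximum and the minimum, and integrability in t makes C_0 meaningful. *)
definition admissible_green ::
    "(real \<Rightarrow> real \<Rightarrow> real) \<Rightarrow> real \<Rightarrow> real \<Rightarrow> real \<Rightarrow> bool" where
  "admissible_green G \<alpha> \<beta> \<eta>\<^sub>0 \<longleftrightarrow>
     (\<forall>t\<in>{0..1}. \<forall>s\<in>{0..1}. 0 \<le> G t s) \<and>
     (\<forall>s\<in>{0..1}. \<exists>t\<^sub>0\<in>{0..1}. \<forall>t\<in>{0..1}. G t s \<le> G t\<^sub>0 s) \<and>
     (\<forall>s\<in>{0<..<1}. 0 < green_max G s) \<and>
     0 \<le> \<alpha> \<and> \<alpha> < \<beta> \<and> \<beta> \<le> 1 \<and> 0 < \<eta>\<^sub>0 \<and> \<eta>\<^sub>0 \<le> 1 \<and>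
     (\<forall>s\<in>{0..1}. \<exists>t\<^sub>0\<in>{\<alpha>..\<beta>}. \<forall>t\<in>{\<alpha>..\<beta>}. G t\<^sub>0 s \<le> G t s) \<and>
     (\<forall>s\<in>{0..1}. (INF t\<in>{\<alpha>..\<beta>}. G t s) \<ge> \<eta>\<^sub>0 * green_max G s) \<and>
     (\<forall>s\<in>{0<..<1}. integrable (lebesgue_on {0..1}) (\<lambda>t. G t s)) \<and>
     0 < green_C0 G \<and> green_C0 G < 1"

definition hybrid_cone ::
    "(real \<Rightarrow> real) \<Rightarrow> (real \<Rightarrow> real \<Rightarrow> real) \<Rightarrow> real \<Rightarrow> real \<Rightarrow> real \<Rightarrow> (real \<Rightarrow> real) set" where
  "hybrid_cone p G \<alpha> \<beta> \<eta>\<^sub>0 =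
     {u. continuous_on {0..1} u \<and>
         (\<forall>t\<in>{0..1}. 0 \<le> u t) \<and>
         (INF t\<in>{\<alpha>..\<beta>}. u t) \<ge> \<eta>\<^sub>0 * sup_norm u \<and>
         integral\<^sup>L (lebesgue_on {0..1}) u \<ge> green_C0 G * luxemburg_norm p u}"

end

theory Submission
  imports Defs
begin

text \<open>Both estimates come from testing the modular against constants. Put m =
  \<open>\<eta>\<^sub>0 * sup_norm u\<close> and s = p^-/q. The cone condition gives u \<ge> m on
  [\<alpha>,\<beta>], where the exponent p/q is at least s. A scale \<delta> below m (\<beta> -
  \<alpha>)^(1/s) would make the modular at least (m/\<delta>)^s (\<beta> - \<alpha>) > 1, so no
  such scale is admissible in the infimum; this is \<open>luxemburg_norm_ge\<close>, and 1/s = q/p^-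
  is the exponent in the theorem. For the second estimate, [0,1] has measure 1, so every Luxemburg
  norm is at most the supremum norm (\<open>luxemburg_norm_le_bound\<close>), and the sup norm in
  the first estimate may be replaced by the smaller L^p(.) norm.\<close>

lemma luxemburg_norm_le:
  assumes "0 < \<delta>"
    and "(\<integral>\<^sup>+ x. ennreal (\<bar>u x / \<delta>\<bar> powr r x) \<partial>(lebesgue_on {0..1})) \<le> 1"
  shows "luxemburg_norm r u \<le> \<delta>"
  unfolding luxemburg_norm_def
  by (rule cInf_lower) (use assms in \<open>auto intro!: bdd_belowI[of _ 0]\<close>)

text \<open>The integrand is a number in [0,1] raised to a nonnegative power, hence at most 1, and
  the domain has measure 1.\<close>

lemma modular_le_1:
  fixes u r :: "real \<Rightarrow> real"
  assumes \<delta>: "0 < \<delta>"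
    and u: "\<And>x. x \<in> {0..1} \<Longrightarrow> \<bar>u x\<bar> \<le> \<delta>"
    and r: "\<And>x. x \<in> {0..1} \<Longrightarrow> 0 \<le> r x"
  shows "(\<integral>\<^sup>+ x. ennreal (\<bar>u x / \<delta>\<bar> powr r x) \<partial>(lebesgue_on {0..1})) \<le> 1"
proof -
  have le1: "\<bar>u x / \<delta>\<bar> powr r x \<le> 1" if x: "x \<in> {0..1}" for x
    using powr_mono2[OF r[OF x], of "\<bar>u x / \<delta>\<bar>" 1] u[OF x] \<delta> by simp
  have "(\<integral>\<^sup>+ x. ennreal (\<bar>u x / \<delta>\<bar> powr r x) \<partial>(lebesgue_on {0..1}))
      \<le> (\<integral>\<^sup>+ x. 1 \<partial>(lebesgue_on {0..1::real}))"
    by (intro nn_integral_mono) (simp add: space_restrict_space le1 del: abs_divide)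
  also have "\<dots> = 1"
    by (simp add: emeasure_restrict_space space_restrict_space)
  finally show ?thesis .
qed

text \<open>M may be 0, which is not an admissible scale, so \<open>modular_le_1\<close> is applied
  to M + e for every e > 0.\<close>

lemma luxemburg_norm_le_bound:
  assumes "0 \<le> M"
    and "\<And>x. x \<in> {0..1} \<Longrightarrow> \<bar>u x\<bar> \<le> M"
    and "\<And>x. x \<in> {0..1} \<Longrightarrow> 0 \<le> r x"
  shows "luxemburg_norm r u \<le> M"
proof (rule field_le_epsilon)
  fix e :: real
  assume "0 < e"
  with assms(1,2) have "0 < M + e" and "\<And>x. x \<in> {0..1} \<Longrightarrow> \<bar>u x\<bar> \<le> M + e"
    by (auto intro: order_trans[of _ M])
  then show "luxemburg_norm r u \<le> M + e"
    by (intro luxemburg_norm_le modular_le_1 assms(3))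
qed

text \<open>Too small a scale makes the part of the modular over [\<alpha>,\<beta>] alone exceed 1.
  The bound M guarantees that some scale is admissible.\<close>

lemma luxemburg_norm_ge:
  assumes ab: "0 \<le> \<alpha>" "\<alpha> < \<beta>" "\<beta> \<le> 1"
    and s: "0 < s"
    and m: "0 \<le> m"
    and u: "\<And>x. x \<in> {\<alpha>..\<beta>} \<Longrightarrow> m \<le> \<bar>u x\<bar>"
    and r: "\<And>x. x \<in> {\<alpha>..\<beta>} \<Longrightarrow> s \<le> r x"
    and r0: "\<And>x. x \<in> {0..1} \<Longrightarrow> 0 \<le> r x"
    and bound: "\<And>x. x \<in> {0..1} \<Longrightarrow> \<bar>u x\<bar> \<le> M"
  shows "m * (\<beta> - \<alpha>) powr (1 / s) \<le> luxemburg_norm r u"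
  unfolding luxemburg_norm_def
proof (rule cInf_greatest)
  \<comment> \<open>A lower bound passes to a real \<open>Inf\<close> only for a nonempty set; M + 1
    is a positive scale that dominates |u|.\<close>
  have "0 \<le> M"
    using bound[of 0] by simp
  then have "(\<integral>\<^sup>+ x. ennreal (\<bar>u x / (M + 1)\<bar> powr r x) \<partial>(lebesgue_on {0..1})) \<le> 1"
    using bound by (intro modular_le_1 r0) (auto intro: order_trans[of _ M])
  with \<open>0 \<le> M\<close> show "{\<delta>. 0 < \<delta> \<and>
      (\<integral>\<^sup>+ x. ennreal (\<bar>u x / \<delta>\<bar> powr r x) \<partial>(lebesgue_on {0..1})) \<le> 1} \<noteq> {}"
    by (auto intro!: exI[of _ "M + 1"])
next
  fix \<delta>
  assume "\<delta> \<in> {\<delta>. 0 < \<delta> \<and>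
      (\<integral>\<^sup>+ x. ennreal (\<bar>u x / \<delta>\<bar> powr r x) \<partial>(lebesgue_on {0..1})) \<le> 1}"
  then have \<delta>: "0 < \<delta>"
    and le1: "(\<integral>\<^sup>+ x. ennreal (\<bar>u x / \<delta>\<bar> powr r x) \<partial>(lebesgue_on {0..1})) \<le> 1"
    by auto
  show "m * (\<beta> - \<alpha>) powr (1 / s) \<le> \<delta>"
  proof (rule ccontr)
    assume "\<not> ?thesis"
    then have lt: "\<delta> < m * (\<beta> - \<alpha>) powr (1 / s)" by simp
    define L where "L = \<beta> - \<alpha>"
    define a where "a = m / \<delta>"
    have L: "0 < L" "L \<le> 1"
      using ab by (auto simp: L_def)
    have aL: "1 < a * L powr (1 / s)"
      using lt \<delta> by (simp add: a_def L_def field_simps)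
    have a0: "0 \<le> a"
      using m \<delta> by (simp add: a_def)
    \<comment> \<open>Since L \<le> 1, the assumed inequality forces a \<ge> 1. This matters because
      only for a base at least 1 does raising the exponent from s to \<open>r x\<close> increase the
      power.\<close>
    have "L powr (1 / s) \<le> 1"
      using L s powr_mono2[of "1 / s" L 1] by simp
    then have a1: "1 \<le> a"
      using aL a0 mult_left_mono[of "L powr (1 / s)" 1 a] by linarith
    \<comment> \<open>Raising to the power s turns the root of L into the length of the interval
      itself.\<close>
    have "1 < (a * L powr (1 / s)) powr s"
      using powr_less_mono2[OF s, of 1] aL by simp
    then have big: "1 < a powr s * L"
      using a0 L s by (simp add: powr_mult powr_powr)
    have low: "a powr s \<le> \<bar>u x / \<delta>\<bar> powr r x" if x: "x \<in> {\<alpha>..\<beta>}" for x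
    proof -
      have "a \<le> \<bar>u x / \<delta>\<bar>"
        using u[OF x] \<delta> by (simp add: a_def divide_right_mono)
      moreover have "a powr s \<le> a powr r x"
        using r[OF x] a1 by (rule powr_mono)
      ultimately show ?thesis
        using powr_mono2[of "r x" a "\<bar>u x / \<delta>\<bar>"] r[OF x] s a0 by linarith
    qed
    \<comment> \<open>The left side is the integral of the step function a^s on [\<alpha>,\<beta>],
      extended by 0, which lies below the integrand of the modular.\<close>
    have "ennreal (a powr s * L) = ennreal (a powr s) * emeasure (lebesgue_on {0..1}) {\<alpha>..\<beta>}"
      using ab by (simp add: emeasure_restrict_space L_def ennreal_mult)
    also have "\<dots> = (\<integral>\<^sup>+ x. ennreal (a powr s) * indicator {\<alpha>..\<beta>} x \<partial>(lebesgue_on {0..1}))"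
      using ab by (subst nn_integral_cmult_indicator) (auto simp: sets_restrict_space_iff)
    also have "\<dots> \<le> (\<integral>\<^sup>+ x. ennreal (\<bar>u x / \<delta>\<bar> powr r x) \<partial>(lebesgue_on {0..1}))"
      by (intro nn_integral_mono) (auto simp: indicator_def low simp del: abs_divide intro!: ennreal_leI)
    also have "\<dots> \<le> 1" by (rule le1)
    finally show False
      using big by simp
  qed
qed

theorem lemma2p17:
  fixes p u :: "real \<Rightarrow> real"
    and G :: "real \<Rightarrow> real \<Rightarrow> real"
    and \<alpha> \<beta> \<eta>\<^sub>0 q :: real
  assumes "admissible_exponent p"
    and "admissible_green G \<alpha> \<beta> \<eta>\<^sub>0"
    and "1 < q" and "q < exponent_min p"
    and "u \<in> hybrid_cone p G \<alpha> \<beta> \<eta>\<^sub>0"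
  shows "luxemburg_norm (\<lambda>x. p x / q) u
           \<ge> \<eta>\<^sub>0 * (\<beta> - \<alpha>) powr (q / exponent_min p) * sup_norm u
       \<and> \<eta>\<^sub>0 * (\<beta> - \<alpha>) powr (q / exponent_min p) * luxemburg_norm p u
           \<le> luxemburg_norm (\<lambda>x. p x / q) u"
proof -
  have ab: "0 \<le> \<alpha>" "\<alpha> < \<beta>" "\<beta> \<le> 1" and eta: "0 < \<eta>\<^sub>0"
    using assms(2) by (auto simp: admissible_green_def)
  have p1: "\<And>t. t \<in> {0..1} \<Longrightarrow> 1 < p t"
    using assms(1) by (auto simp: admissible_exponent_def)
  have pmin: "exponent_min p \<le> p t" if "t \<in> {0..1}" for t
    unfolding exponent_min_def using that p1
    by (intro cINF_lower bdd_belowI2[where m = 1]) (auto intro: less_imp_le)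
  have cont: "continuous_on {0..1} u" and u0: "\<And>t. t \<in> {0..1} \<Longrightarrow> 0 \<le> u t"
    and inf: "\<eta>\<^sub>0 * sup_norm u \<le> (INF t\<in>{\<alpha>..\<beta>}. u t)"
    using assms(5) by (auto simp: hybrid_cone_def)
  \<comment> \<open>Compactness of the image makes the supremum a genuine upper bound, as
    \<open>SUP\<close> on the reals requires boundedness.\<close>
  have "compact ((\<lambda>t. \<bar>u t\<bar>) ` {0..1})"
    by (intro compact_continuous_image continuous_intros cont) simp
  then have sup: "\<bar>u t\<bar> \<le> sup_norm u" if "t \<in> {0..1}" for t
    unfolding sup_norm_def using that
    by (intro cSUP_upper bounded_imp_bdd_above compact_imp_bounded) auto
  have sup0: "0 \<le> sup_norm u"
    using sup[of 0] by simp
  have low: "\<eta>\<^sub>0 * sup_norm u \<le> \<bar>u t\<bar>" if t: "t \<in> {\<alpha>..\<beta>}" for t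
  proof -
    have "(INF t\<in>{\<alpha>..\<beta>}. u t) \<le> u t"
      using t ab by (intro cINF_lower bdd_belowI2[where m = 0] u0) auto
    with inf show ?thesis by linarith
  qed
  \<comment> \<open>Here s is p^-/q, a lower bound of p/q, and m is the cone's lower bound for u on
    [\<alpha>,\<beta>].\<close>
  have "\<eta>\<^sub>0 * sup_norm u * (\<beta> - \<alpha>) powr (1 / (exponent_min p / q))
      \<le> luxemburg_norm (\<lambda>x. p x / q) u"
  proof (rule luxemburg_norm_ge[OF ab _ _ low])
    show "exponent_min p / q \<le> p x / q" if "x \<in> {\<alpha>..\<beta>}" for x
      using that ab assms(3) by (intro divide_right_mono pmin) auto
    show "0 \<le> p x / q" if "x \<in> {0..1}" for x
      using p1[OF that] assms(3) by simp
  qed (use assms(3,4) eta sup0 sup in auto)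
  then have first: "\<eta>\<^sub>0 * (\<beta> - \<alpha>) powr (q / exponent_min p) * sup_norm u
      \<le> luxemburg_norm (\<lambda>x. p x / q) u"
    by (simp add: mult_ac)
  have "luxemburg_norm p u \<le> sup_norm u"
    using sup0 sup by (rule luxemburg_norm_le_bound) (use p1 in force)+
  then have "\<eta>\<^sub>0 * (\<beta> - \<alpha>) powr (q / exponent_min p) * luxemburg_norm p u
      \<le> \<eta>\<^sub>0 * (\<beta> - \<alpha>) powr (q / exponent_min p) * sup_norm u"
    using eta by (intro mult_left_mono) auto
  with first show ?thesis by linarith
qed

end
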